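(* For all integers $n\geq 0$ and all integers $r$ with $1\leq r\leq 4$, $$DSOME(625n+125r+26)\equiv 0\pmod{8}.$$
   Context: For an integer $n\ge 0$, $DSOME(n)$ denotes the sum of all the odd parts in all the partitions of $n$ into distinct parts minus the sum of all the even parts in all the partitions of $n$ into distinct parts. That is, $DSOME(n)=\sum_{\lambda}\left(\sum_{\lambda_i \text{ odd}}\lambda_i-\sum_{\lambda_i\text{ even}}\lambda_i\right)$, where $\lambda$ runs over all partitions of $n$ into distinct parts and $\lambda_i$ runs over the parts of $\lambda$; in particular $DSOME(0)=0$. *)

theory Defs
  imports "HOL-Number_Theory.Cong"
begin

text \<open>
  A partition of \<open>n\<close> into distinct parts is determined by its set of parts, so it is
  represented by that set: a finite set of positive integers whose elements sum to \<open>n\<close>.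
\<close>

definition distinct_partitions :: "nat \<Rightarrow> nat set set" where
  "distinct_partitions n = {P. finite P \<and> 0 \<notin> P \<and> \<Sum>P = n}"

text \<open>Integer-valued, because the difference can be negative.\<close>

definition DSOME :: "nat \<Rightarrow> int" where
  "DSOME n = (\<Sum>P\<in>distinct_partitions n.
     (\<Sum>k\<in>{k\<in>P. odd k}. int k) - (\<Sum>k\<in>{k\<in>P. even k}. int k))"

text \<open>The outer sum in \<open>DSOME\<close> is a genuine finite sum.\<close>

lemma finite_distinct_partitions: "finite (distinct_partitions n)"
proof (rule finite_subset)
  show "distinct_partitions n \<subseteq> Pow {..n}"
    by (auto simp: distinct_partitions_def intro: member_le_sum[where f = "\<lambda>x. x", simplified])
qed simp

lemma distinct_partitions_0: "distinct_partitions 0 = {{}}"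
  by (auto simp: distinct_partitions_def)

lemma DSOME_0: "DSOME 0 = 0"
  by (simp add: DSOME_def distinct_partitions_0)

end

theory Submission
  imports Defs "HOL-Computational_Algebra.Formal_Power_Series"
begin

text \<open>
  Let \<open>Q(n)\<close> be the number of partitions of \<open>n\<close> into distinct parts and \<open>C(n)\<close> the total number of
  parts congruent to 2 modulo 4 in them; then \<open>DSOME(n) \<equiv> n Q(n) + 4 C(n)\<close> modulo 8. Let \<open>P\<close> and \<open>f\<close>
  be the products of all \<open>1 + q\<^sup>i\<close> and of all \<open>1 - q\<^sup>i\<close>, and let \<open>\<theta>\<^sub>a\<close> be the sum of
  \<open>(-1)\<^sup>y q\<^bsup>a y\<^sup>2\<^esup>\<close> over all integers \<open>y\<close>. Gauss's identity \<open>P \<theta>\<^sub>1 = f\<close> gives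
  \<open>P \<equiv> f (2 \<theta>\<^sub>2 - \<theta>\<^sub>1)\<close> modulo 8, because \<open>\<theta>\<^sub>1 (2 \<theta>\<^sub>2 - \<theta>\<^sub>1) \<equiv> 1\<close>. Modulo 2, the generating
  function of \<open>C\<close> is \<open>f (\<theta>\<^sub>2 + \<theta>\<^sub>4 - 2) / 2\<close>, since the number of odd divisors of \<open>L\<close> is odd
  exactly if \<open>L\<close> is a square or twice a square.

  By Euler's pentagonal number theorem the coefficient of \<open>q\<^sup>n\<close> in \<open>f \<theta>\<^sub>a\<close> is a signed count of the
  solutions of \<open>x\<^sup>2 + 24 a y\<^sup>2 = 24 n + 1\<close>. For the given \<open>n\<close>, the right-hand side is \<open>125 k\<close> with \<open>k\<close>
  prime to 5. For \<open>a = 2\<close> there are no solutions, as 5 is inert in \<open>\<rat>(\<surd>-48)\<close>. For \<open>a = 1\<close> and \<open>a = 4\<close>,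
  factoring in \<open>\<int>[\<surd>-24]\<close> expresses the count by solutions of \<open>x\<^sup>2 + 24 y\<^sup>2 = 5 k\<close>, whose number
  up to conjugation is even; this makes the coefficients divisible by 8 and by 4.
\<close>

section \<open>Representations by \<open>x\<^sup>2 + 24 y\<^sup>2\<close>\<close>

text \<open>Removing a two-element orbit \<open>{a, g a}\<close> leaves a smaller set with the same
  properties.\<close>

lemma even_card_fixpoint_free_involution:
  assumes "finite A" and "\<And>x. x \<in> A \<Longrightarrow> g x \<in> A" and "\<And>x. x \<in> A \<Longrightarrow> g (g x) = x"
    and "\<And>x. x \<in> A \<Longrightarrow> g x \<noteq> x"
  shows "even (card A)"
  using assms
proof (induction "card A" arbitrary: A rule: less_induct)
  case less
  show ?case
  proof (cases "A = {}")
    case False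
    then obtain a where a: "a \<in> A" by blast
    define B where "B = A - {a, g a}"
    have card: "card A = card B + 2"
    proof -
      have "card {a, g a} = 2" using less.prems(4)[OF a] by (simp add: card_insert_if)
      moreover have "{a, g a} \<subseteq> A" using a less.prems(2) by auto
      ultimately show ?thesis unfolding B_def using less.prems(1)
        by (metis add.commute card_Diff_subset card_mono finite_subset le_add_diff_inverse)
    qed
    have "even (card B)"
    proof (rule less.hyps)
      show "g x \<in> B" if "x \<in> B" for x
        using that less.prems(2,3) a unfolding B_def by (metis Diff_iff insert_iff singletonD)
    qed (use card less.prems in \<open>auto simp: B_def\<close>)
    then show ?thesis by (simp add: card)
  qed simp
qed

definition parity_sign :: "int \<Rightarrow> int" where
  "parity_sign j = (if even j then 1 else -1)"

text \<open>
  The exponents \<open>j (3 j + 1) / 2\<close> of the pentagonal number series satisfy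
  \<open>24 (j (3 j + 1) / 2) + 1 = (6 j + 1)\<^sup>2\<close>.
\<close>

definition theta_reps :: "int \<Rightarrow> int \<Rightarrow> (int \<times> int) set" where
  "theta_reps a m = {(j, y). (6 * j + 1)\<^sup>2 + 24 * a * y\<^sup>2 = m}"

lemma abs_le_power2_int: "\<bar>i\<bar> \<le> i\<^sup>2" for i :: int
  by (metis abs_ge_zero power2_abs power2_eq_square abs_le_square_iff mult_left_mono
      mult.right_neutral mult_eq_0_iff abs_eq_0 int_one_le_iff_zero_less zero_less_abs_iff order_refl)

lemma finite_theta_reps:
  assumes "a > 0"
  shows "finite (theta_reps a m)"
proof (rule finite_subset)
  show "theta_reps a m \<subseteq> {-m-1..m+1} \<times> {-m-1..m+1}"
  proof (clarsimp simp: theta_reps_def)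
    fix j y :: int
    assume m: "m = (6 * j + 1)\<^sup>2 + 24 * a * y\<^sup>2"
    have "\<bar>6 * j + 1\<bar> \<le> (6 * j + 1)\<^sup>2" "\<bar>y\<bar> \<le> y\<^sup>2" by (rule abs_le_power2_int)+
    moreover have "1 * y\<^sup>2 \<le> 24 * a * y\<^sup>2" using assms by (intro mult_right_mono) auto
    moreover have "0 \<le> (6 * j + 1)\<^sup>2" "0 \<le> y\<^sup>2" by auto
    ultimately show "- (6 * j + 1)\<^sup>2 - 24 * a * y\<^sup>2 - 1 \<le> j \<and> j \<le> (6 * j + 1)\<^sup>2 + 24 * a * y\<^sup>2 + 1 \<and>
       - (6 * j + 1)\<^sup>2 - 24 * a * y\<^sup>2 - 1 \<le> y \<and> y \<le> (6 * j + 1)\<^sup>2 + 24 * a * y\<^sup>2 + 1"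
      by linarith
  qed
qed simp

text \<open>
  With \<open>x = 6 j + 1\<close>, these are the \<open>x + y \<surd>-24\<close> of norm \<open>5 k\<close> that lie in one of the two
  prime ideals above 5.
\<close>

definition reps5 :: "int \<Rightarrow> (int \<times> int) set" where
  "reps5 k = {(j, y) \<in> theta_reps 1 (5 * k). 5 dvd 6 * j + 1 - y}"

lemma finite_reps5: "finite (reps5 k)"
  by (rule finite_subset[OF _ finite_theta_reps[of 1 "5 * k"]]) (auto simp: reps5_def)

text \<open>
  The involution is \<open>(x, y) \<mapsto> (-(x + 24 y) / 5, (y - x) / 5)\<close>. It comes from writing
  \<open>x = 2 a - 3 b\<close>, \<open>y = -(a + b) / 2\<close> with \<open>2 a\<^sup>2 + 3 b\<^sup>2 = k\<close> and changing the sign of \<open>b\<close>.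
\<close>

lemma even_card_reps5: "even (card (reps5 k))"
proof (rule even_card_fixpoint_free_involution[OF finite_reps5])
  let ?g = "\<lambda>(j, y). (- ((j + 4 * y + 1) div 5), (y - 6 * j - 1) div 5) :: int \<times> int"
  have *: "?g v \<in> reps5 k \<and> ?g (?g v) = v \<and> ?g v \<noteq> v" if "v \<in> reps5 k" for v
  proof -
    obtain j y where v: "v = (j, y)" by (cases v)
    have eq: "(6 * j + 1)\<^sup>2 + 24 * y\<^sup>2 = 5 * k" and "5 dvd 6 * j + 1 - y"
      using that by (auto simp: reps5_def theta_reps_def v)
    then obtain c where y: "y = 6 * j + 1 - 5 * c" by (metis dvdE diff_eq_eq add_diff_cancel_left' add.commute)
    have 1: "(j + 4 * y + 1) div 5 = 5 * j + 1 - 4 * c" "(y - 6 * j - 1) div 5 = - c"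
      unfolding y by presburger+
    have g: "?g v = (4 * c - 5 * j - 1, - c)" by (simp add: v 1)
    have "?g (?g v) = v" unfolding g unfolding v y by simp
    \<comment> \<open>A fixed point would force \<open>4 * c = 6 * j + 1\<close>, which fails by
      parity.\<close>
    moreover have "?g v \<noteq> v" unfolding g unfolding v y by simp presburger
    moreover have "?g v \<in> reps5 k" unfolding g using eq
      by (auto simp: reps5_def theta_reps_def y power2_eq_square algebra_simps)
    ultimately show ?thesis by blast
  qed
  show "?g v \<in> reps5 k" "?g (?g v) = v" "?g v \<noteq> v" if "v \<in> reps5 k" for v
    using *[OF that] by blast+
qed

lemma prime_5_int: "prime (5 :: int)"
  by simp

lemma even_sum_odd:
  assumes "finite A" "even (card A)" "\<And>x. x \<in> A \<Longrightarrow> odd (g x)"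
  shows "even (\<Sum>x\<in>A. g x :: int)"
proof -
  have "{a \<in> A. odd (g a)} = A" using assms(3) by auto
  then show ?thesis using assms(1,2) by (simp add: even_sum_iff)
qed

lemma five_dvd_square_int: "(5::int) dvd x\<^sup>2 \<longleftrightarrow> 5 dvd x"
  by (simp add: prime_dvd_power_iff)

lemma five_dvd_of_125k:
  fixes x y k :: int
  assumes "x\<^sup>2 + 24 * y\<^sup>2 = 125 * k"
  shows "5 dvd x \<longleftrightarrow> 5 dvd y"
proof -
  have "x\<^sup>2 = y\<^sup>2 + 5 * (25 * k - 5 * y\<^sup>2)" using assms by simp
  then have "5 dvd x\<^sup>2 \<longleftrightarrow> 5 dvd y\<^sup>2" by (metis dvd_add_left_iff dvd_triv_left)
  then show ?thesis by (simp add: five_dvd_square_int)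
qed

text \<open>
  An element of norm \<open>125 k\<close> is either divisible by 5, or it is up to conjugation the product of
  an element of \<open>reps5 k\<close> with \<open>1 + \<surd>-24\<close>, which generates the square of a prime ideal above 5.
  The sign in \<open>-5 j - 1\<close> keeps \<open>x = 6 j + 1\<close> congruent to 1 modulo 6.
\<close>

lemma sum_theta_reps_125:
  fixes F :: "int \<times> int \<Rightarrow> int"
  assumes k: "\<not> 5 dvd k" and sym: "\<And>j y. F (j, - y) = F (j, y)"
  shows "(\<Sum>v\<in>theta_reps 1 (125 * k). F v) =
    2 * (\<Sum>(j, y)\<in>reps5 k. F (- 5 * j - 1, 5 * y) + F (j - 4 * y, 6 * j + 1 + y))"
proof -
  let ?V = "theta_reps 1 (125 * k)"
  \<comment> \<open>Modulo 25 the form is (x - y)(x + y) with \<open>x = 6 * j + 1\<close>. If 5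
    does not divide y, it divides at most one of the two factors, so 25 divides that factor; this
    selects \<open>V1\<close> or \<open>V2\<close>, which conjugation exchanges.\<close>
  define V0 where "V0 = {(j, y) \<in> ?V. 5 dvd y}"
  define V1 where "V1 = {(j, y) \<in> ?V. \<not> 5 dvd y \<and> 25 dvd y - (6 * j + 1)}"
  define V2 where "V2 = {(j, y) \<in> ?V. \<not> 5 dvd y \<and> 25 dvd - y - (6 * j + 1)}"
  define c where "c = (\<lambda>(j, y). (j, - y) :: int \<times> int)"
  have fin: "finite V0" "finite V1" "finite V2"
    by (rule finite_subset[OF _ finite_theta_reps[of 1 "125 * k"]]; force simp: V0_def V1_def V2_def)+
  have "?V = V0 \<union> V1 \<union> V2"
  proof -
    have "25 dvd y - x \<or> 25 dvd - y - x"
      if "x\<^sup>2 + 24 * y\<^sup>2 = 125 * k" "\<not> 5 dvd y" for x y :: int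
    proof -
      have "25 * (5 * k - y\<^sup>2) = (x - y) * (x + y)"
        using that(1) by (simp add: power2_eq_square algebra_simps)
      then have d: "25 dvd (x - y) * (x + y)" by (metis dvd_triv_left)
      have "\<not> (5 dvd x - y \<and> 5 dvd x + y)" using that(2) by presburger
      then have "coprime (5^2) (x - y) \<or> coprime (5^2) (x + y)"
        by (metis coprime_power_left_iff prime_5_int prime_imp_coprime)
      then have "25 dvd x - y \<or> 25 dvd x + y"
        using d by (auto simp: coprime_dvd_mult_right_iff coprime_dvd_mult_left_iff)
      then show ?thesis
      proof -
        have "y - x = - (x - y)" "- y - x = - (x + y)" by simp_all
        then show ?thesis using \<open>25 dvd x - y \<or> 25 dvd x + y\<close> by (metis dvd_minus_iff)
      qed
    qed
    then show ?thesis unfolding V0_def V1_def V2_def theta_reps_def by auto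
  qed
  moreover have "V0 \<inter> V1 = {}" "(V0 \<union> V1) \<inter> V2 = {}"
  proof -
    have False if "\<not> 5 dvd y" "25 dvd y - x" "25 dvd - y - x" for x y :: int
    proof -
      have "25 dvd 2 * y" using dvd_diff[OF that(2,3)] by simp
      then show False using that(1) by presburger
    qed
    then show "V0 \<inter> V1 = {}" "(V0 \<union> V1) \<inter> V2 = {}"
      unfolding V0_def V1_def V2_def by blast+
  qed
  ultimately have "sum F ?V = sum F V0 + sum F V1 + sum F V2"
    using fin by (simp add: sum.union_disjoint)
  moreover have "sum F V2 = sum F V1"
  proof (rule sum.reindex_bij_witness[of _ c c])
    have *: "(\<forall>v\<in>V2. c v \<in> V1) \<and> (\<forall>v\<in>V1. c v \<in> V2)"
      by (auto simp: V1_def V2_def c_def theta_reps_def)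
    show "c v \<in> V1" if "v \<in> V2" for v using * that by blast
    show "c v \<in> V2" if "v \<in> V1" for v using * that by blast
  qed (auto simp: c_def sym)
  \<comment> \<open>The map multiplies x + y sqrt(-24) by 1 + sqrt(-24), of norm 25; its inverse
    multiplies by the conjugate and divides by 25.\<close>
  moreover have "sum F V1 = (\<Sum>(j, y)\<in>reps5 k. F (j - 4 * y, 6 * j + 1 + y))"
  proof (rule sum.reindex_bij_witness[of _ "\<lambda>(j, y). (j - 4 * y, 6 * j + 1 + y)"
          "\<lambda>(j, y). ((j + 4 * y - 4) div 25, (y - 6 * j - 1) div 25)"])
    fix v assume "v \<in> V1"
    then obtain j y where v: "v = (j, y)" and eq: "(6 * j + 1)\<^sup>2 + 24 * y\<^sup>2 = 125 * k" and y5: "\<not> 5 dvd y"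
      and "25 dvd y - (6 * j + 1)" by (auto simp: V1_def theta_reps_def)
    then obtain d where "y - (6 * j + 1) = 25 * d" by (elim dvdE)
    then have y: "y = 6 * j + 1 + 25 * d" by simp
    have 1: "(j + 4 * y - 4) div 25 = j + 4 * d" "(y - 6 * j - 1) div 25 = d"
    proof -
      have "j + 4 * y - 4 = 25 * (j + 4 * d)" "y - 6 * j - 1 = 25 * d" unfolding y by simp_all
      then show "(j + 4 * y - 4) div 25 = j + 4 * d" "(y - 6 * j - 1) div 25 = d" by simp_all
    qed
    show "(\<lambda>(j, y). (j - 4 * y, 6 * j + 1 + y)) ((\<lambda>(j, y). ((j + 4 * y - 4) div 25, (y - 6 * j - 1) div 25)) v) = v"
      unfolding v prod.case 1 by (simp add: y)
    have "(6 * (j + 4 * d) + 1)\<^sup>2 + 24 * d\<^sup>2 = 5 * k"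
      using eq by (simp add: y power2_eq_square algebra_simps)
    moreover from this have "5 dvd (6 * (j + 4 * d) + 1 - d) * (6 * (j + 4 * d) + 1 + d)"
    proof -
      assume "(6 * (j + 4 * d) + 1)\<^sup>2 + 24 * d\<^sup>2 = 5 * k"
      then have "5 * (k - 5 * d\<^sup>2) = (6 * (j + 4 * d) + 1 - d) * (6 * (j + 4 * d) + 1 + d)"
        by (simp add: power2_eq_square algebra_simps)
      then show ?thesis by (metis dvd_triv_left)
    qed
    \<comment> \<open>The number on the right is the original second coordinate \<open>y\<close>,
      rewritten.\<close>
    moreover have "\<not> 5 dvd 6 * (j + 4 * d) + 1 + d" using y5 y by presburger
    ultimately show "(\<lambda>(j, y). ((j + 4 * y - 4) div 25, (y - 6 * j - 1) div 25)) v \<in> reps5 k"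
      unfolding v prod.case 1 reps5_def theta_reps_def
      by (simp add: prime_dvd_mult_iff)
    show "(case (\<lambda>(j, y). ((j + 4 * y - 4) div 25, (y - 6 * j - 1) div 25)) v of
        (j, y) \<Rightarrow> F (j - 4 * y, 6 * j + 1 + y)) = F v"
      unfolding v prod.case 1 by (simp add: y algebra_simps)
  next
    fix v assume "v \<in> reps5 k"
    then obtain j y where v: "v = (j, y)" and eq: "(6 * j + 1)\<^sup>2 + 24 * y\<^sup>2 = 5 * k"
      and "5 dvd 6 * j + 1 - y" by (auto simp: reps5_def theta_reps_def)
    then obtain d where "6 * j + 1 - y = 5 * d" by (elim dvdE)
    then have y: "y = 6 * j + 1 - 5 * d" by simp
    show "(\<lambda>(j, y). ((j + 4 * y - 4) div 25, (y - 6 * j - 1) div 25)) ((\<lambda>(j, y). (j - 4 * y, 6 * j + 1 + y)) v) = v"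
      unfolding v by simp
    \<comment> \<open>Otherwise 5 divides both coordinates, so 25 divides \<open>5 * k\<close> and 5
      divides \<open>k\<close>.\<close>
    have "\<not> 5 dvd 6 * j + 1 + y"
    proof
      assume "5 dvd 6 * j + 1 + y"
      then have "5 dvd 6 * j + 1" unfolding y by presburger
      then obtain e where e: "6 * j + 1 = 5 * e" by (elim dvdE)
      have "5 * k = 5 * (5 * (e\<^sup>2 + 24 * (e - d)\<^sup>2))" using eq unfolding y e by (simp add: power2_eq_square algebra_simps)
      then have "k = 5 * (e\<^sup>2 + 24 * (e - d)\<^sup>2)" by (simp only: mult_cancel_left) simp
      then show False using k by simp
    qed
    moreover have "(6 * (j - 4 * y) + 1)\<^sup>2 + 24 * (6 * j + 1 + y)\<^sup>2 = 25 * ((6 * j + 1)\<^sup>2 + 24 * y\<^sup>2)"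
      by (simp add: power2_eq_square algebra_simps)
    ultimately show "(\<lambda>(j, y). (j - 4 * y, 6 * j + 1 + y)) v \<in> V1"
      unfolding v V1_def theta_reps_def using eq by simp
  qed
  \<comment> \<open>The map (x, y) to (-x/5, y/5) sends \<open>V0\<close> onto all solutions for
    \<open>5 * k\<close>. These split into \<open>reps5 k\<close> and its conjugate
    \<open>U\<close>, disjoint because 5 does not divide \<open>k\<close>; by symmetry of
    \<open>F\<close> both have the same sum.\<close>
  moreover have "sum F V0 = 2 * (\<Sum>(j, y)\<in>reps5 k. F (- 5 * j - 1, 5 * y))"
  proof -
    define U where "U = {(j, y) \<in> theta_reps 1 (5 * k). 5 dvd 6 * j + 1 + y}"
    have finU: "finite U" "finite (reps5 k)"
      by (rule finite_subset[OF _ finite_theta_reps[of 1 "5 * k"]]; force simp: U_def reps5_def)+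
    have T: "theta_reps 1 (5 * k) = reps5 k \<union> U"
    proof -
      have "5 dvd x - y \<or> 5 dvd x + y" if "x\<^sup>2 + 24 * y\<^sup>2 = 5 * k" for x y :: int
      proof -
        have "5 * (k - 5 * y\<^sup>2) = (x - y) * (x + y)"
          using that by (simp add: power2_eq_square algebra_simps)
        then have "5 dvd (x - y) * (x + y)" by (metis dvd_triv_left)
        then show ?thesis by (simp add: prime_dvd_mult_iff)
      qed
      then show ?thesis unfolding reps5_def U_def theta_reps_def by auto
    qed
    have disj: "reps5 k \<inter> U = {}"
    proof -
      have False if "x\<^sup>2 + 24 * y\<^sup>2 = 5 * k" "5 dvd x - y" "5 dvd x + y" for x y :: int
      proof -
        have "5 dvd 2 * x" "5 dvd 2 * y" using dvd_add[OF that(2,3)] dvd_diff[OF that(3,2)] by simp_all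
        then have "5 dvd x" "5 dvd y" by presburger+
        then obtain e f where "x = 5 * e" "y = 5 * f" by (elim dvdE)
        then have "5 * k = 5 * (5 * (e\<^sup>2 + 24 * f\<^sup>2))" using that(1) by (simp add: power2_eq_square algebra_simps)
        then have "k = 5 * (e\<^sup>2 + 24 * f\<^sup>2)" by (simp only: mult_cancel_left) simp
        then show False using k by simp
      qed
      then show ?thesis unfolding reps5_def U_def theta_reps_def by auto
    qed
    let ?G = "\<lambda>(j, y). F (- 5 * j - 1, 5 * y)"
    have "sum F V0 = sum ?G (theta_reps 1 (5 * k))"
    proof (rule sum.reindex_bij_witness[of _ "\<lambda>(j, y). (- 5 * j - 1, 5 * y)" "\<lambda>(j, y). (- ((j + 1) div 5), y div 5)"])
      fix v assume "v \<in> V0"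
      then obtain j y where v: "v = (j, y)" and eq: "(6 * j + 1)\<^sup>2 + 24 * y\<^sup>2 = 125 * k" and "5 dvd y"
        by (auto simp: V0_def theta_reps_def)
      then have "5 dvd 6 * j + 1" using five_dvd_of_125k[OF eq] by simp
      then have "5 dvd j + 1" by presburger
      then obtain i z where "j + 1 = 5 * i" and y: "y = 5 * z" using \<open>5 dvd y\<close> by (elim dvdE)
      then have j: "j = 5 * i - 1" by simp
      show "(\<lambda>(j, y). (- 5 * j - 1, 5 * y)) ((\<lambda>(j, y). (- ((j + 1) div 5), y div 5)) v) = v"
           "(case (\<lambda>(j, y). (- ((j + 1) div 5), y div 5)) v of (j, y) \<Rightarrow> F (- 5 * j - 1, 5 * y)) = F v"
        by (simp_all add: v j y)
      show "(\<lambda>(j, y). (- ((j + 1) div 5), y div 5)) v \<in> theta_reps 1 (5 * k)"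
        using eq by (simp add: v j y theta_reps_def power2_eq_square algebra_simps)
    next
      fix v assume "v \<in> theta_reps 1 (5 * k)"
      then obtain j y where v: "v = (j, y)" and eq: "(6 * j + 1)\<^sup>2 + 24 * y\<^sup>2 = 5 * k"
        by (auto simp: theta_reps_def)
      show "(\<lambda>(j, y). (- ((j + 1) div 5), y div 5)) ((\<lambda>(j, y). (- 5 * j - 1, 5 * y)) v) = v"
        by (simp add: v)
      show "(\<lambda>(j, y). (- 5 * j - 1, 5 * y)) v \<in> V0"
        using eq by (simp add: v V0_def theta_reps_def power2_eq_square algebra_simps)
    qed
    also have "\<dots> = sum ?G (reps5 k) + sum ?G U"
      unfolding T using finU disj by (simp add: sum.union_disjoint)
    also have "sum ?G U = sum ?G (reps5 k)"
      by (rule sum.reindex_bij_witness[of _ c c])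
         (use sym[of _ "5 * _"] in \<open>auto simp: reps5_def U_def c_def theta_reps_def\<close>)
    finally show ?thesis by simp
  qed
  ultimately show ?thesis by (simp add: sum.distrib case_prod_unfold)
qed

text \<open>Both terms that \<open>sum_theta_reps_125\<close> attaches to a pair in
  \<open>reps5 k\<close> equal \<open>- parity_sign (j + y)\<close>. The sum is therefore -4 times a
  sum of evenly many signs.\<close>

lemma eight_dvd_theta_sum:
  assumes "\<not> 5 dvd k"
  shows "8 dvd (\<Sum>(j, y)\<in>theta_reps 1 (125 * k). parity_sign (j + y))"
proof -
  have "(\<Sum>(j, y)\<in>theta_reps 1 (125 * k). parity_sign (j + y)) =
      2 * (\<Sum>(j, y)\<in>reps5 k. - 2 * parity_sign (j + y))"
    by (subst sum_theta_reps_125[OF assms])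
       (auto simp: parity_sign_def intro!: sum.cong)
  also have "\<dots> = - 4 * (\<Sum>(j, y)\<in>reps5 k. parity_sign (j + y))"
    by (simp add: sum_distrib_left case_prod_unfold)
  finally have *: "(\<Sum>(j, y)\<in>theta_reps 1 (125 * k). parity_sign (j + y)) = \<dots>" .
  have "even (\<Sum>(j, y)\<in>reps5 k. parity_sign (j + y))"
    by (rule even_sum_odd) (auto simp: even_card_reps5 finite_reps5 parity_sign_def split: if_splits)
  then show ?thesis unfolding * by (elim dvdE) simp
qed

text \<open>Solutions for \<open>a = 4\<close> are those for \<open>a = 1\<close> with even second
  coordinate, so \<open>?F\<close> is set to 0 at odd ones. Of \<open>5 * y\<close> and
  \<open>6 * j + 1 + y\<close> exactly one is even, so each pair in \<open>reps5 k\<close>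
  contributes a single sign, and there are evenly many pairs.\<close>

lemma four_dvd_theta_sum:
  assumes "\<not> 5 dvd k"
  shows "4 dvd (\<Sum>(j, y)\<in>theta_reps 4 (125 * k). parity_sign (j + y))"
proof -
  let ?F = "\<lambda>(j, y). if even y then parity_sign (j + y div 2) else 0"
  have "(\<Sum>(j, y)\<in>theta_reps 4 (125 * k). parity_sign (j + y)) = sum ?F {(j, y) \<in> theta_reps 1 (125 * k). even y}"
    by (rule sum.reindex_bij_witness[of _ "\<lambda>(j, y). (j, y div 2)" "\<lambda>(j, y). (j, 2 * y)"])
       (auto simp: theta_reps_def elim!: evenE)
  also have "\<dots> = sum ?F (theta_reps 1 (125 * k))"
    by (rule sum.mono_neutral_left) (auto simp: finite_theta_reps split: if_splits)
  also have "\<dots> = 2 * (\<Sum>(j, y)\<in>reps5 k. ?F (- 5 * j - 1, 5 * y) + ?F (j - 4 * y, 6 * j + 1 + y))"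
  proof (rule sum_theta_reps_125[OF assms])
    have "even (j + (- y) div 2) \<longleftrightarrow> even (j + y div 2)" if "even y" for j y :: int
      using that by presburger
    then show "?F (j, - y) = ?F (j, y)" for j y
      by (simp add: parity_sign_def)
  qed
  finally have *: "(\<Sum>(j, y)\<in>theta_reps 4 (125 * k). parity_sign (j + y)) = \<dots>" .
  have "even (\<Sum>(j, y)\<in>reps5 k. ?F (- 5 * j - 1, 5 * y) + ?F (j - 4 * y, 6 * j + 1 + y))"
    by (rule even_sum_odd) (auto simp: even_card_reps5 finite_reps5 parity_sign_def split: if_splits)
  then show ?thesis unfolding * by (elim dvdE) simp
qed

text \<open>As -48 is congruent to 2 modulo 5, a non-square, 5 divides the form only if it divides
  both x and y. So 5 occurs in its nonzero values to an even power, but in \<open>125 * k\<close> to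
  the third.\<close>

lemma theta_reps_2_empty:
  assumes "\<not> 5 dvd k"
  shows "theta_reps 2 (125 * k) = {}"
proof -
  have descent: "5 dvd x \<and> 5 dvd y" if "5 dvd x\<^sup>2 + 48 * y\<^sup>2" for x y :: int
  proof -
    define a b where "a = x mod 5" and "b = y mod 5"
    have "a \<in> {0..4}" "b \<in> {0..4}" by (auto simp: a_def b_def)
    moreover have "{0..4} = {0, 1, 2, 3, 4 :: int}" by auto
    moreover have "(a\<^sup>2 + 48 * b\<^sup>2) mod 5 = (x\<^sup>2 + 48 * y\<^sup>2) mod 5"
      unfolding a_def b_def by (intro mod_add_cong mod_mult_cong refl) (simp_all add: power_mod)
    then have "(a\<^sup>2 + 48 * b\<^sup>2) mod 5 = 0" using that by simp
    ultimately have "a = 0 \<and> b = 0" by auto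
    then show ?thesis by (simp add: a_def b_def dvd_eq_mod_eq_0)
  qed
  have False if eq: "x\<^sup>2 + 48 * y\<^sup>2 = 125 * k" for x y :: int
  proof -
    have "5 dvd x \<and> 5 dvd y" by (rule descent) (simp add: eq)
    then obtain u v where "x = 5 * u" "y = 5 * v" by (elim conjE dvdE)
    then have eq': "u\<^sup>2 + 48 * v\<^sup>2 = 5 * k" using eq by (simp add: power2_eq_square algebra_simps)
    have "5 dvd u \<and> 5 dvd v" by (rule descent) (simp add: eq')
    then obtain s t where "u = 5 * s" "v = 5 * t" by (elim conjE dvdE)
    then have "5 * k = 5 * (5 * (s\<^sup>2 + 48 * t\<^sup>2))" using eq' by (simp add: power2_eq_square algebra_simps)
    then have "k = 5 * (s\<^sup>2 + 48 * t\<^sup>2)" by (simp only: mult_cancel_left) simp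
    then show False using assms by simp
  qed
  then show ?thesis unfolding theta_reps_def by auto
qed

section \<open>Truncated identities of Euler and Gauss\<close>

lemma sum_symmetric_int_interval:
  "(\<Sum>j\<in>{-int (Suc N)..int (Suc N)}. g j) = (\<Sum>j\<in>{-int N..int N}. g j) + g (int (Suc N)) + g (- int (Suc N))"
  for g :: "int \<Rightarrow> 'a::comm_monoid_add"
proof -
  have "{-int (Suc N)..int (Suc N)} = insert (int (Suc N)) (insert (- int (Suc N)) {-int N..int N})"
    by auto
  then show ?thesis by (simp add: add_ac)
qed

lemma sum_telescope_atMost:
  fixes V :: "nat \<Rightarrow> 'a::comm_ring_1"
  shows "(\<Sum>s\<le>n. V (Suc s) - V s) = V (Suc n) - V 0"
  using sum_lessThan_telescope[of V "Suc n"] by (simp only: lessThan_Suc_atMost)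

lemma of_int_parity_sign_of_nat:
  "of_int (parity_sign (int n)) = (-1 :: 'a::ring_1) ^ n"
  "of_int (parity_sign (- int n)) = (-1 :: 'a::ring_1) ^ n"
  by (simp_all add: parity_sign_def)

text \<open>
  The terms with \<open>s > 0\<close> on the right-hand sides below are divisible by \<open>x ^ (N + 1)\<close>, so
  modulo that power the identities are those of Euler and Gauss.
\<close>

lemma shanks_pentagonal:
  fixes x :: "'a::comm_ring_1"
  shows "(\<Sum>j\<in>{-int N..int N}. of_int (parity_sign j) * x ^ nat (j * (3 * j + 1) div 2)) =
    (\<Sum>s\<le>N. (-1) ^ s * (\<Prod>i=s..<N. 1 - x ^ Suc i) * x ^ (s * N + s * (s + 1) div 2))"
proof (induction N)
  case (Suc N)
  \<comment> \<open>Passing from \<open>N\<close> to \<open>Suc N\<close> changes the summand at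
    \<open>s\<close> by \<open>V (Suc s) - V s\<close>, so the change telescopes. The product in
    \<open>V s\<close> begins with \<open>1 - x ^ s\<close>; the explicit 0 records that this factor
    vanishes at \<open>s = 0\<close>, where \<open>s - 1\<close> would be truncated.\<close>
  define V where "V = (\<lambda>s. (-1) ^ s * (if s = 0 then 0 else \<Prod>i=s-1..<N. 1 - x ^ Suc i) *
     x ^ (s * N + s * (s + 1) div 2))"
  have tri: "Suc s * (Suc s + 1) div 2 = s * (s + 1) div 2 + s + 1" for s :: nat
    by (simp add: algebra_simps)
  have step: "(-1) ^ s * (\<Prod>i=s..<Suc N. 1 - x ^ Suc i) * x ^ (s * Suc N + s * (s + 1) div 2)
      - (-1) ^ s * (\<Prod>i=s..<N. 1 - x ^ Suc i) * x ^ (s * N + s * (s + 1) div 2) = V (Suc s) - V s"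
    if "s \<le> N" for s
  proof -
    have p: "(if s = 0 then 0 else \<Prod>i=s-1..<N. 1 - x ^ Suc i) = (1 - x ^ s) * (\<Prod>i=s..<N. 1 - x ^ Suc i)"
      using that by (cases s) (simp_all add: prod.atLeast_Suc_lessThan)
    show ?thesis unfolding V_def p tri using that
      by (simp add: prod.atLeastLessThan_Suc power_add algebra_simps)
  qed
  have "(\<Sum>s\<le>Suc N. (-1) ^ s * (\<Prod>i=s..<Suc N. 1 - x ^ Suc i) * x ^ (s * Suc N + s * (s + 1) div 2))
    - (\<Sum>s\<le>N. (-1) ^ s * (\<Prod>i=s..<N. 1 - x ^ Suc i) * x ^ (s * N + s * (s + 1) div 2))
    = (\<Sum>s\<le>N. V (Suc s) - V s) + (-1) ^ Suc N * x ^ (Suc N * Suc N + Suc N * (Suc N + 1) div 2)"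
  proof -
    have "(\<Sum>s\<le>N. (-1) ^ s * (\<Prod>i=s..<Suc N. 1 - x ^ Suc i) * x ^ (s * Suc N + s * (s + 1) div 2))
      - (\<Sum>s\<le>N. (-1) ^ s * (\<Prod>i=s..<N. 1 - x ^ Suc i) * x ^ (s * N + s * (s + 1) div 2))
      = (\<Sum>s\<le>N. V (Suc s) - V s)"
      unfolding sum_subtractf[symmetric] by (intro sum.cong refl step) simp
    then show ?thesis unfolding sum.atMost_Suc[of _ N] add_diff_eq[symmetric]
      by (simp add: add.commute[of _ "_ * x ^ (Suc N * Suc N + _)"] flip: add_diff_eq)
  qed
  also have "(\<Sum>s\<le>N. V (Suc s) - V s) = (-1) ^ Suc N * x ^ (Suc N * N + Suc N * (Suc N + 1) div 2)"
    unfolding sum_telescope_atMost by (simp add: V_def)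
  \<comment> \<open>The new summand at \<open>s = Suc N\<close> is the pentagonal term for
    \<open>j = Suc N\<close>; the boundary term of the telescoping sum is the one for
    \<open>j = - Suc N\<close>.\<close>
  also have "Suc N * Suc N + Suc N * (Suc N + 1) div 2 = nat (int (Suc N) * (3 * int (Suc N) + 1) div 2)"
  proof -
    have "int (Suc N) * (3 * int (Suc N) + 1) div 2 = int (Suc N * Suc N + Suc N * (Suc N + 1) div 2)"
      by (simp add: zdiv_int algebra_simps)
    then show ?thesis by linarith
  qed
  also have "Suc N * N + Suc N * (Suc N + 1) div 2 = nat (- int (Suc N) * (3 * (- int (Suc N)) + 1) div 2)"
  proof -
    have "- int (Suc N) * (3 * (- int (Suc N)) + 1) div 2 = int (Suc N * N + Suc N * (Suc N + 1) div 2)"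
      by (simp add: zdiv_int algebra_simps)
    then show ?thesis by linarith
  qed
  finally show ?case
    unfolding sum_symmetric_int_interval Suc.IH of_int_parity_sign_of_nat
    by (simp only: diff_eq_eq add_ac)
qed (simp add: parity_sign_def)

text \<open>The sum telescopes as in \<open>shanks_pentagonal\<close>, once the old summands are
  multiplied by \<open>1 + x ^ Suc N\<close>, the new factor on the left.\<close>

lemma shanks_gauss:
  fixes x :: "'a::comm_ring_1"
  shows "(\<Prod>i<N. 1 + x ^ Suc i) * (\<Sum>j\<in>{-int N..int N}. of_int (parity_sign j) * x ^ nat (j\<^sup>2)) =
    (\<Sum>s\<le>N. (-1) ^ s * (\<Prod>i=s..<N. 1 - x ^ Suc i) * (\<Prod>i<s. 1 + x ^ i) * x ^ (s * Suc N))"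
proof (induction N)
  case (Suc N)
  define V where "V = (\<lambda>s. (-1) ^ s * (if s = 0 then 0 else \<Prod>i=s-1..<N. 1 - x ^ Suc i) *
     (\<Prod>i<s. 1 + x ^ i) * x ^ (s * Suc N))"
  have step: "(-1) ^ s * (\<Prod>i=s..<Suc N. 1 - x ^ Suc i) * (\<Prod>i<s. 1 + x ^ i) * x ^ (s * Suc (Suc N))
      = (1 + x ^ Suc N) * ((-1) ^ s * (\<Prod>i=s..<N. 1 - x ^ Suc i) * (\<Prod>i<s. 1 + x ^ i) * x ^ (s * Suc N))
      + (V (Suc s) - V s)"
    if "s \<le> N" for s
  proof -
    have p: "(if s = 0 then 0 else \<Prod>i=s-1..<N. 1 - x ^ Suc i) = (1 - x ^ s) * (\<Prod>i=s..<N. 1 - x ^ Suc i)"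
      using that by (cases s) (simp_all add: prod.atLeast_Suc_lessThan)
    show ?thesis unfolding V_def p using that
      by (simp add: prod.atLeastLessThan_Suc power_add algebra_simps)
  qed
  \<comment> \<open>The factor \<open>1 + x ^ 0\<close> supplies the 2 that accounts for the two new
    terms at \<open>j = Suc N\<close> and \<open>j = - Suc N\<close>.\<close>
  have E: "(\<Prod>i<Suc N. 1 + x ^ i) * (1 + x ^ Suc N) = 2 * (\<Prod>i<Suc N. 1 + x ^ Suc i)"
  proof -
    have "(\<Prod>i<Suc N. 1 + x ^ i) * (1 + x ^ Suc N) = (\<Prod>i<Suc (Suc N). 1 + x ^ i)" by simp
    also have "\<dots> = 2 * (\<Prod>i<Suc N. 1 + x ^ Suc i)" by (subst prod.lessThan_Suc_shift) simp
    finally show ?thesis .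
  qed
  let ?T = "\<lambda>s. (-1) ^ s * (\<Prod>i=s..<N. 1 - x ^ Suc i) * (\<Prod>i<s. 1 + x ^ i) * x ^ (s * Suc N)"
  have "(\<Sum>s\<le>Suc N. (-1) ^ s * (\<Prod>i=s..<Suc N. 1 - x ^ Suc i) * (\<Prod>i<s. 1 + x ^ i) * x ^ (s * Suc (Suc N)))
    = (\<Sum>s\<le>N. (1 + x ^ Suc N) * ?T s + (V (Suc s) - V s)) +
      (-1) ^ Suc N * (\<Prod>i<Suc N. 1 + x ^ i) * x ^ (Suc N * Suc (Suc N))"
    unfolding sum.atMost_Suc[of _ N]
    by (rule arg_cong2[where f = "(+)"]) (intro sum.cong refl step, simp_all)
  also have "(\<Sum>s\<le>N. (1 + x ^ Suc N) * ?T s + (V (Suc s) - V s)) =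
      (1 + x ^ Suc N) * (\<Sum>s\<le>N. ?T s) + V (Suc N)"
    unfolding sum.distrib sum_telescope_atMost sum_distrib_left by (simp add: V_def)
  also have "V (Suc N) = (-1) ^ Suc N * (\<Prod>i<Suc N. 1 + x ^ i) * x ^ (Suc N * Suc N)"
    by (simp add: V_def)
  also have "(1 + x ^ Suc N) * (\<Sum>s\<le>N. ?T s) + (-1) ^ Suc N * (\<Prod>i<Suc N. 1 + x ^ i) * x ^ (Suc N * Suc N)
      + (-1) ^ Suc N * (\<Prod>i<Suc N. 1 + x ^ i) * x ^ (Suc N * Suc (Suc N))
    = (1 + x ^ Suc N) * (\<Sum>s\<le>N. ?T s) + (-1) ^ Suc N * ((\<Prod>i<Suc N. 1 + x ^ i) * (1 + x ^ Suc N)) * x ^ (Suc N * Suc N)"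
    by (simp only: mult_Suc_right[of "Suc N" "Suc N"] power_add) (simp add: algebra_simps)
  also have "\<dots> = (\<Prod>i<Suc N. 1 + x ^ Suc i) *
      (\<Sum>j\<in>{-int (Suc N)..int (Suc N)}. of_int (parity_sign j) * x ^ nat (j\<^sup>2))"
  proof -
    have "nat ((int (Suc N))\<^sup>2) = Suc N * Suc N" "nat ((- int (Suc N))\<^sup>2) = Suc N * Suc N"
      unfolding power2_minus by (simp_all only: power2_eq_square nat_int flip: of_nat_mult)
    then show ?thesis
      unfolding sum_symmetric_int_interval Suc.IH[symmetric] of_int_parity_sign_of_nat E
      by (simp only: prod.lessThan_Suc) (simp only: algebra_simps mult_2)
  qed
  finally show ?case by (rule sym)
qed (simp add: parity_sign_def)

section \<open>Congruences of power series up to a fixed degree\<close>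

unbundle fps_syntax

text \<open>Comparing only coefficients up to \<open>N\<close> lets finite products and sums stand
  in for the infinite ones.\<close>

definition fps_cong :: "int \<Rightarrow> nat \<Rightarrow> int fps \<Rightarrow> int fps \<Rightarrow> bool" where
  "fps_cong m N A B \<longleftrightarrow> (\<forall>i\<le>N. [A $ i = B $ i] (mod m))"

lemma fps_cong_refl [simp]: "fps_cong m N A A"
  by (simp add: fps_cong_def)

lemma fps_cong_sym: "fps_cong m N A B \<Longrightarrow> fps_cong m N B A"
  by (simp add: fps_cong_def cong_sym_eq)

lemma fps_cong_trans [trans]: "fps_cong m N A B \<Longrightarrow> fps_cong m N B C \<Longrightarrow> fps_cong m N A C"
  unfolding fps_cong_def by (meson cong_trans)

lemma fps_cong_add: "fps_cong m N A B \<Longrightarrow> fps_cong m N C D \<Longrightarrow> fps_cong m N (A + C) (B + D)"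
  by (simp add: fps_cong_def cong_add)

lemma fps_cong_sum: "(\<And>x. x \<in> S \<Longrightarrow> fps_cong m N (f x) (g x)) \<Longrightarrow> fps_cong m N (sum f S) (sum g S)"
  by (simp add: fps_cong_def fps_sum_nth cong_sum)

lemma fps_cong_mult: "fps_cong m N A B \<Longrightarrow> fps_cong m N C D \<Longrightarrow> fps_cong m N (A * C) (B * D)"
  unfolding fps_cong_def fps_mult_nth by (intro allI impI cong_sum cong_mult) auto

lemma fps_cong_prod: "(\<And>x. x \<in> S \<Longrightarrow> fps_cong m N (f x) (g x)) \<Longrightarrow> fps_cong m N (prod f S) (prod g S)"
  by (induction S rule: infinite_finite_induct) (auto intro: fps_cong_mult)

lemma fps_cong_dvd: "of_int m dvd A - B \<Longrightarrow> fps_cong m N A B"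
proof -
  assume "of_int m dvd A - B"
  then obtain C where "A - B = of_int m * C" by (elim dvdE)
  then have "A - B = fps_const m * C" by (metis fps_of_int of_int_eq_id id_apply)
  then have "(A - B) $ i = m * C $ i" for i by simp
  then show ?thesis unfolding fps_cong_def cong_iff_dvd_diff by (metis dvd_triv_left fps_sub_nth)
qed

lemma fps_cong_X_power:
  assumes "N < k"
  shows "fps_cong m N (A + R * fps_X ^ k) A"
  using assms by (simp add: fps_cong_def fps_X_power_mult_right_nth)

lemma fps_cong_first_term:
  assumes "\<And>s. 0 < s \<Longrightarrow> s \<le> N \<Longrightarrow> t s = R s * fps_X ^ e s" "\<And>s. 0 < s \<Longrightarrow> N < e s"
  shows "fps_cong m N (\<Sum>s\<le>N. t s) (t 0)"
proof -
  have "fps_cong m N (\<Sum>s\<in>{1..N}. t s) (\<Sum>s\<in>{1..N}. 0)"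
  proof (rule fps_cong_sum)
    fix s assume "s \<in> {1..N}"
    then show "fps_cong m N (t s) 0"
      using fps_cong_X_power[of N "e s" m 0 "R s"] assms by simp
  qed
  moreover have "(\<Sum>s\<le>N. t s) = t 0 + (\<Sum>s\<in>{1..N}. t s)"
    by (simp add: atMost_atLeast0 sum.atLeast_Suc_atMost)
  ultimately show ?thesis using fps_cong_add[OF fps_cong_refl, of m N _ 0 "t 0"] by simp
qed

section \<open>Theta series and the pentagonal series modulo 2 and 8\<close>

definition theta :: "nat \<Rightarrow> nat \<Rightarrow> int fps" where
  "theta a N = (\<Sum>y\<in>{-int N..int N}. of_int (parity_sign y) * fps_X ^ (a * nat (y\<^sup>2)))"

text \<open>This is (\<open>theta a N\<close> - 1) / 2, given by its own sum so that halving stays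
  within integer series.\<close>

definition half_theta :: "nat \<Rightarrow> nat \<Rightarrow> int fps" where
  "half_theta a N = (\<Sum>y=1..N. (-1) ^ y * fps_X ^ (a * y\<^sup>2))"

definition pent_series :: "nat \<Rightarrow> int fps" where
  "pent_series N = (\<Sum>j\<in>{-int N..int N}. of_int (parity_sign j) * fps_X ^ nat (j * (3 * j + 1) div 2))"

lemma theta_eq_half_theta: "theta a N = 1 + 2 * half_theta a N"
proof (induction N)
  case 0
  then show ?case by (simp add: theta_def half_theta_def parity_sign_def)
next
  case (Suc N)
  have "nat ((int (Suc N))\<^sup>2) = (Suc N)\<^sup>2" "nat ((- int (Suc N))\<^sup>2) = (Suc N)\<^sup>2"
    unfolding power2_minus by (simp_all only: nat_int flip: of_nat_power)
  moreover have "half_theta a (Suc N) = half_theta a N + (-1) ^ Suc N * fps_X ^ (a * (Suc N)\<^sup>2)"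
    by (simp add: half_theta_def)
  ultimately have "theta a (Suc N) = theta a N + 2 * (half_theta a (Suc N) - half_theta a N)"
    unfolding theta_def sum_symmetric_int_interval of_int_parity_sign_of_nat by simp
  then show ?case unfolding Suc.IH by (simp add: algebra_simps)
qed

lemma two_dvd_square_sum:
  fixes f :: "'b \<Rightarrow> 'a::comm_ring_1"
  shows "2 dvd (\<Sum>i\<in>A. f i)\<^sup>2 - (\<Sum>i\<in>A. (f i)\<^sup>2)"
proof (induction A rule: infinite_finite_induct)
  case (insert a A)
  have "(\<Sum>i\<in>insert a A. f i)\<^sup>2 - (\<Sum>i\<in>insert a A. (f i)\<^sup>2) =
    ((\<Sum>i\<in>A. f i)\<^sup>2 - (\<Sum>i\<in>A. (f i)\<^sup>2)) + 2 * (f a * (\<Sum>i\<in>A. f i))"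
    using insert by (simp add: power2_eq_square algebra_simps)
  then show ?case using insert.IH by (metis dvd_add dvd_triv_left)
qed auto

text \<open>Modulo 2 a square is taken term by term, which doubles the exponents, and signs do not
  matter.\<close>

lemma two_dvd_half_theta: "2 dvd (half_theta 1 N)\<^sup>2 - half_theta 2 N"
proof -
  have "2 dvd (\<Sum>y=1..N. ((-1) ^ y * fps_X ^ (1 * y\<^sup>2))\<^sup>2 - (-1) ^ y * (fps_X :: int fps) ^ (2 * y\<^sup>2))"
  proof (rule dvd_sum)
    fix y :: nat
    have "((-1) ^ y * fps_X ^ (1 * y\<^sup>2))\<^sup>2 - (-1) ^ y * fps_X ^ (2 * y\<^sup>2) =
       (if even y then 0 else 2 * fps_X ^ (2 * y\<^sup>2) :: int fps)"
      by (simp add: power_mult_distrib mult.commute flip: power_mult)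
    then show "2 dvd ((-1) ^ y * fps_X ^ (1 * y\<^sup>2))\<^sup>2 - (-1) ^ y * (fps_X :: int fps) ^ (2 * y\<^sup>2)"
      by simp
  qed
  from dvd_add[OF two_dvd_square_sum[of "\<lambda>y. (-1) ^ y * fps_X ^ (1 * y\<^sup>2)" "{1..N}"] this[unfolded sum_subtractf]]
  show ?thesis by (simp add: half_theta_def)
qed

lemma euler_pentagonal: "fps_cong m N (\<Prod>i<N. 1 - fps_X ^ Suc i) (pent_series N)"
proof (rule fps_cong_sym)
  let ?R = "\<lambda>s. (-1) ^ s * (\<Prod>i=s..<N. 1 - fps_X ^ Suc i) :: int fps"
  let ?e = "\<lambda>s. s * N + s * (s + 1) div 2"
  have "N < ?e s" if "0 < s" for s
  proof -
    obtain r where r: "s = Suc r" using \<open>0 < s\<close> gr0_implies_Suc by blast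
    have "s * (s + 1) div 2 \<ge> 1" unfolding r by simp
    moreover have "N \<le> s * N" unfolding r by simp
    ultimately show ?thesis by linarith
  qed
  then have "fps_cong m N (\<Sum>s\<le>N. ?R s * fps_X ^ ?e s) (?R 0 * fps_X ^ ?e 0)"
    by (intro fps_cong_first_term[where R = ?R and e = ?e]) auto
  then show "fps_cong m N (pent_series N) (\<Prod>i<N. 1 - fps_X ^ Suc i)"
    unfolding pent_series_def shanks_pentagonal by (simp add: atLeast0LessThan)
qed

lemma gauss_theta:
  "fps_cong m N ((\<Prod>i<N. 1 + fps_X ^ Suc i) * theta 1 N) (\<Prod>i<N. 1 - fps_X ^ Suc i)"
proof -
  have "fps_cong m N ((\<Prod>i<N. 1 + fps_X ^ Suc i) * theta 1 N)
     ((-1) ^ 0 * (\<Prod>i=0..<N. 1 - fps_X ^ Suc i) * (\<Prod>i<0. 1 + fps_X ^ i) * fps_X ^ (0 * Suc N))"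
    unfolding theta_def mult_1 shanks_gauss
    by (rule fps_cong_first_term[of N _ "\<lambda>s. (-1) ^ s * (\<Prod>i=s..<N. 1 - fps_X ^ Suc i) * (\<Prod>i<s. 1 + fps_X ^ i)"
          "\<lambda>s. s * Suc N"]) (auto simp: gr0_conv_Suc)
  then show ?thesis by (simp add: atLeast0LessThan)
qed

lemma distinct_gf_cong_2: "fps_cong 2 N (\<Prod>i<N. 1 + fps_X ^ Suc i) (pent_series N)"
proof -
  have "fps_cong 2 N (\<Prod>i<N. 1 + fps_X ^ Suc i) (\<Prod>i<N. 1 - fps_X ^ Suc i)"
    by (intro fps_cong_prod fps_cong_dvd) simp
  also note euler_pentagonal
  finally show ?thesis .
qed

text \<open>Write h1, h2 for \<open>half_theta 1 N\<close>, \<open>half_theta 2 N\<close>. Then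
  \<open>theta 1 N * (2 * theta 2 N - theta 1 N)\<close> is 1 - 4 (h1^2 - h2) + 8 h1 h2, and h1^2 -
  h2 is even. So the second factor inverts \<open>theta 1 N\<close> modulo 8 and solves Gauss's
  identity for the product.\<close>

lemma distinct_gf_cong_8:
  "fps_cong 8 N (\<Prod>i<N. 1 + fps_X ^ Suc i) (pent_series N * (2 * theta 2 N - theta 1 N))"
proof -
  define P where "P = (\<Prod>i<N. 1 + fps_X ^ Suc i :: int fps)"
  obtain c where c: "(half_theta 1 N)\<^sup>2 - half_theta 2 N = 2 * c"
    using two_dvd_half_theta[of N] by (elim dvdE)
  have "theta 1 N * (2 * theta 2 N - theta 1 N) =
     1 - 4 * ((half_theta 1 N)\<^sup>2 - half_theta 2 N) + 8 * (half_theta 1 N * half_theta 2 N)"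
    unfolding theta_eq_half_theta by (simp add: power2_eq_square algebra_simps)
  also have "\<dots> = 1 - 8 * (c - half_theta 1 N * half_theta 2 N)"
    unfolding c by (simp add: algebra_simps)
  finally have inv: "theta 1 N * (2 * theta 2 N - theta 1 N) = \<dots>" .
  have "P - P * theta 1 N * (2 * theta 2 N - theta 1 N) = of_int 8 * (P * (c - half_theta 1 N * half_theta 2 N))"
    unfolding mult.assoc inv by (simp add: algebra_simps)
  then have "fps_cong 8 N P (P * theta 1 N * (2 * theta 2 N - theta 1 N))"
    by (intro fps_cong_dvd) (metis dvd_triv_left)
  also have "fps_cong 8 N \<dots> (pent_series N * (2 * theta 2 N - theta 1 N))"
    using gauss_theta euler_pentagonal unfolding P_def
    by (intro fps_cong_mult fps_cong_refl) (rule fps_cong_trans)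
  finally show ?thesis unfolding P_def .
qed

section \<open>Coefficients as signed counts of representations\<close>

lemma monomial_product_nth:
  "(of_int c * fps_X ^ k * (of_int d * fps_X ^ l)) $ n = (if n = k + l then c * d else 0 :: int)"
proof -
  have "of_int c * fps_X ^ k * (of_int d * fps_X ^ l) = fps_const (c * d) * (fps_X ^ (k + l) :: int fps)"
    by (simp add: power_add fps_of_int[symmetric] mult_ac flip: fps_const_mult)
  then show ?thesis by simp
qed

lemma pentagonal_exponent:
  fixes j :: int
  shows "int (nat (j * (3 * j + 1) div 2)) * 24 + 1 = (6 * j + 1)\<^sup>2"
proof -
  have "even (j * (3 * j + 1))" by simp
  then have 2: "2 * (j * (3 * j + 1) div 2) = 3 * j\<^sup>2 + j" by (simp add: power2_eq_square algebra_simps)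
  moreover have "\<bar>j\<bar> \<le> j\<^sup>2" by (rule abs_le_power2_int)
  ultimately have "0 \<le> j * (3 * j + 1) div 2" by linarith
  then have "int (nat (j * (3 * j + 1) div 2)) * 24 = 12 * (2 * (j * (3 * j + 1) div 2))" by simp
  then show ?thesis unfolding 2 by (simp add: power2_eq_square algebra_simps)
qed

text \<open>The product expands into monomials with exponents j (3 j + 1) / 2 + a y^2. Equating such
  an exponent to \<open>n\<close>, multiplying by 24 and adding 1 completes the square.\<close>

lemma pent_theta_nth:
  assumes "a > 0"
  shows "(pent_series n * theta a n) $ n =
    (\<Sum>(j, y)\<in>theta_reps (int a) (24 * int n + 1). parity_sign (j + y))"
proof -
  let ?I = "{- int n..int n}"
  let ?e = "\<lambda>(j, y). nat (j * (3 * j + 1) div 2) + a * nat (y\<^sup>2)"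
  have e: "n = ?e v \<longleftrightarrow> v \<in> theta_reps (int a) (24 * int n + 1)" for v
  proof -
    obtain j y where v: "v = (j, y)" by (cases v)
    have "n = ?e v \<longleftrightarrow> 24 * int n + 1 = 24 * int (?e v) + 1" by linarith
    also have "24 * int (?e v) + 1 = (int (nat (j * (3 * j + 1) div 2)) * 24 + 1) + 24 * int a * y\<^sup>2"
      unfolding v by simp
    finally show ?thesis unfolding pentagonal_exponent by (auto simp: v theta_reps_def)
  qed
  \<comment> \<open>All solutions lie in the summation ranges, so truncating the series at
    \<open>n\<close> loses none.\<close>
  have box: "theta_reps (int a) (24 * int n + 1) \<subseteq> ?I \<times> ?I"
  proof (clarsimp simp: theta_reps_def)
    fix j y :: int
    assume *: "(6 * j + 1)\<^sup>2 + 24 * int a * y\<^sup>2 = 24 * int n + 1"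
    have "(6 * j + 1)\<^sup>2 = 36 * j\<^sup>2 + 12 * j + 1" by (simp add: power2_eq_square algebra_simps)
    moreover have "\<bar>j\<bar> \<le> j\<^sup>2" "\<bar>y\<bar> \<le> y\<^sup>2" by (rule abs_le_power2_int)+
    moreover have "1 * y\<^sup>2 \<le> int a * y\<^sup>2" using assms by (intro mult_right_mono) auto
    ultimately show "- int n \<le> j \<and> j \<le> int n \<and> - int n \<le> y \<and> y \<le> int n" using * by linarith
  qed
  have "(pent_series n * theta a n) $ n =
      (\<Sum>(j, y)\<in>?I \<times> ?I. if n = ?e (j, y) then parity_sign j * parity_sign y else 0)"
    unfolding pent_series_def theta_def sum_product fps_sum_nth monomial_product_nth
    by (simp add: sum.cartesian_product)
  also have "\<dots> = (\<Sum>(j, y)\<in>{v \<in> ?I \<times> ?I. n = ?e v}. parity_sign j * parity_sign y)"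
    by (subst sum.inter_filter) (auto intro!: sum.cong)
  also have "{v \<in> ?I \<times> ?I. n = ?e v} = theta_reps (int a) (24 * int n + 1)"
    unfolding e using box by blast
  also have "(\<Sum>(j, y)\<in>\<dots>. parity_sign j * parity_sign y) = (\<Sum>(j, y)\<in>\<dots>. parity_sign (j + y))"
    by (intro sum.cong) (auto simp: parity_sign_def)
  finally show ?thesis .
qed

text \<open>A pentagonal \<open>n\<close> would give a solution with y = 0. This later removes the
  contribution of the constant terms of the theta series.\<close>

lemma pent_series_nth_eq_0:
  assumes "theta_reps 2 (24 * int n + 1) = {}"
  shows "pent_series N $ n = 0"
proof -
  have "n \<noteq> nat (j * (3 * j + 1) div 2)" for j
  proof
    assume "n = nat (j * (3 * j + 1) div 2)"
    then have "(j, 0) \<in> theta_reps 2 (24 * int n + 1)"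
      using pentagonal_exponent[of j] by (simp add: theta_reps_def)
    then show False using assms by blast
  qed
  then show ?thesis
    unfolding pent_series_def fps_sum_nth
    using monomial_product_nth[of _ _ 1 0 n] by (intro sum.neutral) (simp flip: fps_of_int)
qed

section \<open>Distinct partitions modulo 8\<close>

lemma distinct_partitions_eq:
  assumes "n \<le> N"
  shows "distinct_partitions n = {S. S \<subseteq> {1..N} \<and> \<Sum>S = n}"
proof -
  have 1: "S \<subseteq> {1..N}" if "finite S" "0 \<notin> S" "\<Sum>S = n" for S
  proof
    fix k assume "k \<in> S"
    then have "k \<le> \<Sum>S" using that(1) by (intro member_le_sum) auto
    then show "k \<in> {1..N}" using that assms \<open>k \<in> S\<close> by (cases k) auto
  qed
  have 2: "finite S \<and> 0 \<notin> S" if "S \<subseteq> {1..N}" for S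
    using that by (auto intro: finite_subset)
  show ?thesis unfolding distinct_partitions_def
  proof (rule Collect_cong)
    show "finite S \<and> 0 \<notin> S \<and> \<Sum>S = n \<longleftrightarrow> S \<subseteq> {1..N} \<and> \<Sum>S = n" for S
      using 1[of S] 2[of S] by argo
  qed
qed

lemma prod_1_plus_X_power_nth:
  assumes "finite A"
  shows "(\<Prod>i\<in>A. 1 + fps_X ^ i) $ n = int (card {S. S \<subseteq> A \<and> \<Sum>S = n})"
proof -
  have "(\<Prod>i\<in>A. 1 + fps_X ^ i :: int fps) = (\<Prod>i\<in>A. fps_X ^ i + 1)"
    by (simp add: add.commute)
  also have "\<dots> = (\<Sum>S\<in>Pow A. fps_X ^ (\<Sum>S))"
    by (simp add: prod_add[OF assms] power_sum)
  also have "\<dots> $ n = (\<Sum>S\<in>Pow A. if \<Sum>S = n then 1 else 0)"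
    unfolding fps_sum_nth by (intro sum.cong) auto
  also have "\<dots> = int (card {S \<in> Pow A. \<Sum>S = n})"
    using assms by (simp flip: sum.inter_filter)
  finally show ?thesis by (simp add: Pow_def Collect_conj_eq[symmetric])
qed

lemma distinct_gf_eq: "(\<Prod>i<N. 1 + fps_X ^ Suc i :: int fps) = (\<Prod>i\<in>{1..N}. 1 + fps_X ^ i)"
  by (rule prod.reindex_bij_witness[of _ "\<lambda>i. i - 1" Suc]) auto

lemma card_distinct_partitions:
  assumes "n \<le> N"
  shows "int (card (distinct_partitions n)) = (\<Prod>i<N. 1 + fps_X ^ Suc i) $ n"
  unfolding distinct_gf_eq by (simp add: prod_1_plus_X_power_nth distinct_partitions_eq[OF assms])

lemma card_distinct_partitions_with_part:
  assumes "n \<le> N" "p \<in> {1..N}"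
  shows "int (card {S \<in> distinct_partitions n. p \<in> S}) = (fps_X ^ p * (\<Prod>i\<in>{1..N} - {p}. 1 + fps_X ^ i)) $ n"
proof (cases "n < p")
  case True
  have "p \<le> \<Sum>S" if "S \<in> distinct_partitions n" "p \<in> S" for S
    using that by (intro member_le_sum) (auto simp: distinct_partitions_def)
  then have "{S \<in> distinct_partitions n. p \<in> S} = {}"
    using True by (force simp: distinct_partitions_def)
  then show ?thesis using True by (simp only: fps_X_power_mult_nth) simp
next
  case False
  have "bij_betw (insert p) {S. S \<subseteq> {1..N} - {p} \<and> \<Sum>S = n - p} {S \<in> distinct_partitions n. p \<in> S}"
  proof (rule bij_betw_byWitness[where f' = "\<lambda>S. S - {p}"])
    have "insert p S \<in> distinct_partitions n" if "S \<subseteq> {1..N} - {p}" "\<Sum>S = n - p" for S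
    proof -
      have "finite S" "p \<notin> S" using that by (auto intro: finite_subset)
      then show ?thesis using that False assms(2) unfolding distinct_partitions_eq[OF assms(1)] by auto
    qed
    then show "insert p ` {S. S \<subseteq> {1..N} - {p} \<and> \<Sum>S = n - p} \<subseteq> {S \<in> distinct_partitions n. p \<in> S}" by auto
    have "\<Sum>(S - {p}) = n - p" if "S \<in> distinct_partitions n" "p \<in> S" for S
      using that by (auto simp: distinct_partitions_def sum_diff1_nat)
    then show "(\<lambda>S. S - {p}) ` {S \<in> distinct_partitions n. p \<in> S} \<subseteq> {S. S \<subseteq> {1..N} - {p} \<and> \<Sum>S = n - p}"
      by (auto simp: distinct_partitions_eq[OF assms(1)])
  qed auto
  then have "card {S \<in> distinct_partitions n. p \<in> S} = card {S. S \<subseteq> {1..N} - {p} \<and> \<Sum>S = n - p}"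
    by (rule bij_betw_same_card[symmetric])
  then show ?thesis using False by (simp add: fps_X_power_mult_nth prod_1_plus_X_power_nth)
qed

section \<open>Reduction of \<open>DSOME\<close> modulo 8\<close>

definition double_odd_parts :: "nat \<Rightarrow> nat" where
  "double_odd_parts n = (\<Sum>S\<in>distinct_partitions n. card {k \<in> S. k mod 4 = 2})"

text \<open>Counting an even part \<open>k\<close> positively changes the sum by
  \<open>2 * k\<close>, which modulo 8 is 4 if \<open>k mod 4 = 2\<close> and 0 if 4 divides
  \<open>k\<close>.\<close>

lemma sum_parts_cong:
  assumes "finite S"
  shows "[(\<Sum>k\<in>{k\<in>S. odd k}. int k) - (\<Sum>k\<in>{k\<in>S. even k}. int k) = int (\<Sum>S) + 4 * int (card {k \<in> S. k mod 4 = 2})] (mod 8)"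
proof -
  have "(\<Sum>k\<in>{k\<in>S. odd k}. int k) - (\<Sum>k\<in>{k\<in>S. even k}. int k) = (\<Sum>k\<in>S. (if odd k then int k else 0) - (if even k then int k else 0))"
    unfolding sum_subtractf by (simp only: sum.inter_filter[OF assms])
  also have "[\<dots> = (\<Sum>k\<in>S. int k + (if k mod 4 = 2 then 4 else 0))] (mod 8)"
  proof (rule cong_sum)
    fix k
    show "[(if odd k then int k else 0) - (if even k then int k else 0) = int k + (if k mod 4 = 2 then 4 else 0)] (mod 8)"
    proof (cases "odd k")
      case True
      then have "k mod 4 \<noteq> 2" by presburger
      then show ?thesis using True by simp
    next
      case False
      show ?thesis
      proof (cases "k mod 4 = 2")
        case True
        then obtain c where "k = 4 * c + 2" by (metis mult_div_mod_eq)
        then show ?thesis by (simp add: cong_iff_dvd_diff) presburger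
      next
        case False
        with \<open>\<not> odd k\<close> have "4 dvd k" by presburger
        then obtain c where "k = 4 * c" by (elim dvdE)
        then show ?thesis by (simp add: cong_iff_dvd_diff)
      qed
    qed
  qed
  also have "(\<Sum>k\<in>S. int k + (if k mod 4 = 2 then 4 else 0)) = int (\<Sum>S) + 4 * int (card {k \<in> S. k mod 4 = 2})"
    unfolding sum.distrib by (simp flip: sum.inter_filter[OF assms])
  finally show ?thesis .
qed

lemma DSOME_cong:
  "[DSOME n = int n * int (card (distinct_partitions n)) + 4 * int (double_odd_parts n)] (mod 8)"
proof -
  have "[DSOME n = (\<Sum>S\<in>distinct_partitions n. int n + 4 * int (card {k \<in> S. k mod 4 = 2}))] (mod 8)"
    unfolding DSOME_def
  proof (rule cong_sum)
    fix S assume "S \<in> distinct_partitions n"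
    then show "[(\<Sum>k\<in>{k\<in>S. odd k}. int k) - (\<Sum>k\<in>{k\<in>S. even k}. int k) = int n + 4 * int (card {k \<in> S. k mod 4 = 2})] (mod 8)"
      using sum_parts_cong[of S] by (auto simp: distinct_partitions_def)
  qed
  then show ?thesis
    by (simp add: sum.distrib double_odd_parts_def sum_distrib_left mult.commute)
qed

lemma double_odd_parts_eq:
  assumes "n \<le> N"
  shows "double_odd_parts n = (\<Sum>p\<in>{p \<in> {1..N}. p mod 4 = 2}. card {S \<in> distinct_partitions n. p \<in> S})"
proof -
  let ?B = "{p \<in> {1..N}. p mod 4 = 2}"
  have "double_odd_parts n = (\<Sum>S\<in>distinct_partitions n. \<Sum>p\<in>?B. if p \<in> S then 1 else 0)"
    unfolding double_odd_parts_def
  proof (rule sum.cong)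
    fix S assume "S \<in> distinct_partitions n"
    then have "{k \<in> S. k mod 4 = 2} = {p \<in> ?B. p \<in> S}"
      unfolding distinct_partitions_eq[OF assms] by auto
    then show "card {k \<in> S. k mod 4 = 2} = (\<Sum>p\<in>?B. if p \<in> S then 1 else 0)"
      by (simp flip: sum.inter_filter)
  qed simp
  also have "\<dots> = (\<Sum>p\<in>?B. \<Sum>S\<in>distinct_partitions n. if p \<in> S then 1 else 0)"
    by (rule sum.swap)
  also have "\<dots> = (\<Sum>p\<in>?B. card {S \<in> distinct_partitions n. p \<in> S})"
    by (simp add: finite_distinct_partitions flip: sum.inter_filter)
  finally show ?thesis .
qed

section \<open>Parity of the number of odd divisors\<close>

lemma double_square_ne_square:
  assumes "0 < y" "0 < z"
  shows "2 * y\<^sup>2 \<noteq> (z\<^sup>2 :: nat)"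
proof
  assume *: "2 * y\<^sup>2 = z\<^sup>2"
  have "multiplicity 2 (2 * y\<^sup>2) = Suc (2 * multiplicity 2 y)"
    using assms by (simp add: prime_elem_multiplicity_mult_distrib prime_elem_multiplicity_power_distrib)
  moreover have "multiplicity 2 (z\<^sup>2) = 2 * multiplicity 2 z"
    using assms by (simp add: prime_elem_multiplicity_power_distrib)
  ultimately show False unfolding * by presburger
qed

text \<open>Halving an even \<open>L\<close> keeps its odd divisors and exchanges the two
  alternatives. For odd \<open>L\<close>, pairing \<open>d\<close> with \<open>L div d\<close>
  leaves a divisor unpaired exactly if \<open>L\<close> is a square.\<close>

lemma odd_card_odd_divisors:
  fixes L :: nat
  assumes "0 < L"
  shows "odd (card {d. odd d \<and> d dvd L}) \<longleftrightarrow> (\<exists>y. L = y\<^sup>2) \<or> (\<exists>y. L = 2 * y\<^sup>2)"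
  using assms
proof (induction L rule: less_induct)
  case (less L)
  show ?case
  proof (cases "even L")
    case True
    then obtain M where M: "L = 2 * M" by (elim evenE)
    have "{d. odd d \<and> d dvd L} = {d. odd d \<and> d dvd M}"
      unfolding M by (auto simp: coprime_dvd_mult_right_iff)
    moreover have "(\<exists>y. L = y\<^sup>2) \<longleftrightarrow> (\<exists>y. M = 2 * y\<^sup>2)"
    proof
      assume "\<exists>y. L = y\<^sup>2"
      then obtain y where y: "L = y\<^sup>2" by blast
      then have "even y" using True by simp
      then obtain z where "y = 2 * z" by (elim evenE)
      then have "M = 2 * z\<^sup>2" using y M by (simp add: power2_eq_square)
      then show "\<exists>y. M = 2 * y\<^sup>2" by blast
    next
      assume "\<exists>y. M = 2 * y\<^sup>2"
      then obtain y where "M = 2 * y\<^sup>2" by blast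
      then have "L = (2 * y)\<^sup>2" using M by (simp add: power2_eq_square)
      then show "\<exists>y. L = y\<^sup>2" by blast
    qed
    moreover have "(\<exists>y. L = 2 * y\<^sup>2) \<longleftrightarrow> (\<exists>y. M = y\<^sup>2)" using M by simp
    ultimately show ?thesis using less.IH[of M] less.prems M by auto
  next
    case False
    then have D: "{d. odd d \<and> d dvd L} = {d. d dvd L}" using dvd_trans by blast
    have fin: "finite {d. d dvd L}" using less.prems by simp
    have inv: "L div d dvd L" "L div (L div d) = d" if "d dvd L" for d
      using that less.prems by (auto elim!: dvdE)
    have fixp: "d\<^sup>2 = L" if "d dvd L" "L div d = d" for d
      using that by (metis dvd_mult_div_cancel power2_eq_square)
    show ?thesis
    proof (cases "\<exists>y. L = y\<^sup>2")
      case True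
      then obtain y where y: "L = y\<^sup>2" by blast
      have "even (card ({d. d dvd L} - {y}))"
      proof (rule even_card_fixpoint_free_involution[where g = "\<lambda>d. L div d"])
        fix d assume d: "d \<in> {d. d dvd L} - {y}"
        have "L div y = y" using y less.prems by (simp add: power2_eq_square)
        then show "L div d \<in> {d. d dvd L} - {y}" "L div (L div d) = d"
          using d inv[of d] by auto
        show "L div d \<noteq> d" using d fixp[of d] y by auto
      qed (use fin in simp)
      moreover have "card {d. d dvd L} = Suc (card ({d. d dvd L} - {y}))"
        using fin y by (intro card.remove) auto
      ultimately show ?thesis unfolding D using True by simp
    next
      case False
      have "even (card {d. d dvd L})"
        by (rule even_card_fixpoint_free_involution[where g = "\<lambda>d. L div d"])
           (use fin inv fixp False in auto)
      then show ?thesis unfolding D using False \<open>odd L\<close> by auto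
    qed
  qed
qed

section \<open>The generating function of \<open>double_odd_parts\<close> modulo 2\<close>

lemma odd_half_theta_nth:
  assumes "0 < a" "0 < M" "M \<le> N"
  shows "odd (half_theta a N $ M) \<longleftrightarrow> (\<exists>y. M = a * y\<^sup>2)"
proof -
  have nth: "half_theta a N $ M = (\<Sum>y=1..N. if M = a * y\<^sup>2 then (-1) ^ y else 0)"
  proof -
    have "((-1) ^ y * fps_X ^ (a * y\<^sup>2)) $ M = (if M = a * y\<^sup>2 then (-1) ^ y else 0 :: int)" for y
      by (cases "even y") simp_all
    then show ?thesis by (simp add: half_theta_def fps_sum_nth)
  qed
  show ?thesis
  proof (cases "\<exists>y. M = a * y\<^sup>2")
    case True
    then obtain y where y: "M = a * y\<^sup>2" by blast
    have "y \<le> y\<^sup>2" by (simp add: power2_eq_square)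
    also have "y\<^sup>2 \<le> M" using assms(1) y by simp
    finally have "y \<in> {1..N}" using assms y by (cases y) auto
    moreover have "M = a * z\<^sup>2 \<longleftrightarrow> z = y" for z using y assms(1) by auto
    ultimately have "half_theta a N $ M = (-1) ^ y" unfolding nth by (simp add: sum.delta)
    then show ?thesis using True by simp
  qed (auto simp: nth)
qed

text \<open>On expanding, every power strictly between \<open>x\<close> and \<open>x ^ Suc N\<close>
  occurs twice.\<close>

lemma sum_geometric_mod_2:
  fixes x :: "'a::comm_ring_1"
  assumes "0 < N"
  shows "2 dvd (1 + x) * (\<Sum>t=1..N. x ^ t) - (x + x ^ Suc N)"
  using assms
proof (induction N)
  case (Suc N)
  show ?case
  proof (cases N)
    case (Suc m)
    have "(1 + x) * (\<Sum>t=1..Suc N. x ^ t) - (x + x ^ Suc (Suc N)) =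
       ((1 + x) * (\<Sum>t=1..N. x ^ t) - (x + x ^ Suc N)) + 2 * x ^ Suc N"
      by (simp add: algebra_simps)
    then show ?thesis using Suc.IH Suc by (metis dvd_add dvd_triv_left zero_less_Suc)
  qed (simp add: algebra_simps)
qed simp

text \<open>The coefficient at M > 0 counts the divisors p of M with \<open>p mod 4 = 2\<close>. For
  M = 2 L these are the doubled odd divisors of L, so the count is odd exactly if M is twice or four
  times a square.\<close>

lemma double_odd_divisor_series:
  "fps_cong 2 N (\<Sum>p\<in>{p \<in> {1..N}. p mod 4 = 2}. \<Sum>t=1..N. fps_X ^ (p * t)) (half_theta 2 N + half_theta 4 N)"
  unfolding fps_cong_def
proof (intro allI impI)
  fix M assume "M \<le> N"
  let ?B = "{p \<in> {1..N}. p mod 4 = 2}"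
  let ?A = "\<Sum>p\<in>?B. \<Sum>t=1..N. fps_X ^ (p * t) :: int fps"
  show "[?A $ M = (half_theta 2 N + half_theta 4 N) $ M] (mod 2)"
  proof (cases "M = 0")
    case True
    have "(fps_X ^ (p * t) :: int fps) $ 0 = 0" if "p \<in> ?B" "t \<in> {1..N}" for p t
      using that by auto
    then have "?A $ 0 = 0" unfolding fps_sum_nth by (intro sum.neutral ballI)
    moreover have "half_theta a N $ 0 = 0" if "a > 0" for a
      unfolding half_theta_def fps_sum_nth using that by (intro sum.neutral) auto
    ultimately show ?thesis using True by simp
  next
    case False
    have 1: "(\<Sum>t=1..N. (fps_X ^ (p * t) :: int fps) $ M) = (if p dvd M then 1 else 0)" if "p \<in> ?B" for p
    proof (cases "p dvd M")
      case True
      then obtain u where u: "M = p * u" by (elim dvdE)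
      have "u \<le> M" using u that by simp
      then have "u \<in> {1..N}" using False u \<open>M \<le> N\<close> by (cases u) auto
      moreover have "M = p * t \<longleftrightarrow> t = u" for t using u that by auto
      ultimately show ?thesis using True by simp
    qed (auto intro!: sum.neutral)
    have "?A $ M = (\<Sum>p\<in>?B. if p dvd M then 1 else 0)"
      unfolding fps_sum_nth by (intro sum.cong refl 1)
    also have "\<dots> = int (card {p \<in> ?B. p dvd M})"
      by (simp flip: sum.inter_filter)
    finally have A: "?A $ M = \<dots>" .
    have "odd (card {p \<in> ?B. p dvd M}) \<longleftrightarrow> (\<exists>y. M = 2 * y\<^sup>2) \<or> (\<exists>y. M = 4 * y\<^sup>2)"
    proof (cases "even M")
      case True
      then obtain L where L: "M = 2 * L" by (elim evenE)
      have "bij_betw (\<lambda>d. 2 * d) {d. odd d \<and> d dvd L} {p \<in> ?B. p dvd M}"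
      proof (rule bij_betw_byWitness[where f' = "\<lambda>p. p div 2"])
        have "2 * d \<in> ?B \<and> 2 * d dvd M" if "odd d" "d dvd L" for d
        proof -
          have "d \<le> L" using that False L by (auto dest: dvd_imp_le)
          moreover have "2 * d mod 4 = 2" "d \<noteq> 0" using that(1) by presburger+
          ultimately show ?thesis using that L \<open>M \<le> N\<close> by simp
        qed
        then show "(\<lambda>d. 2 * d) ` {d. odd d \<and> d dvd L} \<subseteq> {p \<in> ?B. p dvd M}" by blast
        have *: "odd (p div 2) \<and> p div 2 dvd L \<and> 2 * (p div 2) = p" if "p mod 4 = 2" "p dvd M" for p
        proof -
          have p: "2 * (p div 2) = p" "odd (p div 2)" using that(1) by presburger+
          moreover have "2 * (p div 2) dvd 2 * L" using p(1) that(2) L by metis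
          then have "p div 2 dvd L" unfolding nat_mult_dvd_cancel_disj by simp
          ultimately show ?thesis by blast
        qed
        show "(\<lambda>p. p div 2) ` {p \<in> ?B. p dvd M} \<subseteq> {d. odd d \<and> d dvd L}"
          by (rule image_subsetI) (use * in blast)
        show "\<forall>p\<in>{p \<in> ?B. p dvd M}. 2 * (p div 2) = p"
          by (rule ballI) (use * in blast)
      qed auto
      then have "card {p \<in> ?B. p dvd M} = card {d. odd d \<and> d dvd L}"
        by (rule bij_betw_same_card[symmetric])
      then show ?thesis using odd_card_odd_divisors[of L] False L by simp
    next
      case False
      have "odd p" if "p dvd M" for p using that False dvd_trans by blast
      moreover have "even p" if "p mod 4 = 2" for p :: nat using that by presburger
      ultimately have empty: "{p \<in> ?B. p dvd M} = {}" by blast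
      have "\<not> (\<exists>y. M = 2 * y\<^sup>2)" "\<not> (\<exists>y. M = 4 * y\<^sup>2)" using False by auto
      then show ?thesis unfolding empty by simp
    qed
    \<comment> \<open>As the two cases exclude each other, the odd coefficients of the two half
      theta series never cancel modulo 2.\<close>
    moreover have "\<not> ((\<exists>y. M = 2 * y\<^sup>2) \<and> (\<exists>y. M = 4 * y\<^sup>2))"
    proof
      assume "(\<exists>y. M = 2 * y\<^sup>2) \<and> (\<exists>y. M = 4 * y\<^sup>2)"
      then obtain y z where yz: "M = 2 * y\<^sup>2" "M = 4 * z\<^sup>2" by blast
      then have "2 * z\<^sup>2 = y\<^sup>2" by simp
      moreover have "0 < z" "0 < y" using yz False by (metis gr0I mult_0_right power_zero_numeral)+
      ultimately show False using double_square_ne_square by blast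
    qed
    ultimately have "odd (?A $ M) \<longleftrightarrow> odd ((half_theta 2 N + half_theta 4 N) $ M)"
      using odd_half_theta_nth[of 2 M N] odd_half_theta_nth[of 4 M N] False \<open>M \<le> N\<close>
      unfolding A fps_add_nth even_add even_of_nat by auto
    then show ?thesis unfolding cong_iff_dvd_diff even_diff even_add by blast
  qed
qed

text \<open>
  Modulo 2 the factor \<open>q\<^sup>p / (1 + q\<^sup>p)\<close> that marks the part \<open>p\<close> is the sum of the \<open>q\<^bsup>p t\<^esup>\<close>.
\<close>

lemma double_odd_parts_cong:
  "[int (double_odd_parts n) = ((\<Prod>i<n. 1 + fps_X ^ Suc i) * (half_theta 2 n + half_theta 4 n)) $ n] (mod 2)"
proof -
  let ?B = "{p \<in> {1..n}. p mod 4 = 2}"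
  let ?P = "\<Prod>i<n. 1 + fps_X ^ Suc i :: int fps"
  let ?R = "\<lambda>p. \<Prod>i\<in>{1..n} - {p}. 1 + fps_X ^ i :: int fps"
  have 1: "int (double_odd_parts n) = (\<Sum>p\<in>?B. fps_X ^ p * ?R p) $ n"
    unfolding double_odd_parts_eq[OF order_refl] of_nat_sum fps_sum_nth
    by (intro sum.cong refl card_distinct_partitions_with_part) auto
  have "fps_cong 2 n (\<Sum>p\<in>?B. fps_X ^ p * ?R p) (\<Sum>p\<in>?B. ?P * (\<Sum>t=1..n. fps_X ^ (p * t)))"
  proof (rule fps_cong_sum)
    fix p assume "p \<in> ?B"
    then have p: "1 \<le> p" "p \<le> n" by auto
    define x where "x = (fps_X ^ p :: int fps)"
    have P: "?P = ?R p * (1 + x)"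
      unfolding distinct_gf_eq x_def using p by (subst prod.remove[of _ p]) (auto simp: mult.commute)
    \<comment> \<open>The end term \<open>x ^ Suc n\<close> of the geometric sum lies beyond degree
      \<open>n\<close>, so it can be added freely.\<close>
    have "n < p * Suc n" using p(1) by (cases p) auto
    then have "fps_cong 2 n (x * ?R p) (x * ?R p + ?R p * fps_X ^ (p * Suc n))"
      by (intro fps_cong_sym[OF fps_cong_X_power])
    also have "x * ?R p + ?R p * fps_X ^ (p * Suc n) = ?R p * (x + x ^ Suc n)"
      unfolding x_def power_mult by (simp add: algebra_simps)
    also have "fps_cong 2 n (?R p * (x + x ^ Suc n)) (?R p * ((1 + x) * (\<Sum>t=1..n. x ^ t)))"
      using sum_geometric_mod_2[of n x] p
      by (intro fps_cong_mult fps_cong_refl fps_cong_sym[OF fps_cong_dvd]) auto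
    also have "?R p * ((1 + x) * (\<Sum>t=1..n. x ^ t)) = ?P * (\<Sum>t=1..n. fps_X ^ (p * t))"
      unfolding P x_def power_mult by (simp only: mult.assoc)
    finally show "fps_cong 2 n (fps_X ^ p * ?R p) (?P * (\<Sum>t=1..n. fps_X ^ (p * t)))"
      unfolding x_def .
  qed
  also have "(\<Sum>p\<in>?B. ?P * (\<Sum>t=1..n. fps_X ^ (p * t))) = ?P * (\<Sum>p\<in>?B. \<Sum>t=1..n. fps_X ^ (p * t))"
    by (rule sum_distrib_left[symmetric])
  also have "fps_cong 2 n \<dots> (?P * (half_theta 2 n + half_theta 4 n))"
    by (intro fps_cong_mult fps_cong_refl double_odd_divisor_series)
  finally show ?thesis unfolding 1 by (simp add: fps_cong_def)
qed

section \<open>The congruence for \<open>DSOME\<close> on the given progressions\<close>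

theorem theorem1p3:
  fixes n r :: nat
  assumes "1 \<le> r" and "r \<le> 4"
  shows "[DSOME (625 * n + 125 * r + 26) = 0] (mod 8)"
proof -
  define m where "m = 625 * n + 125 * r + 26"
  \<comment> \<open>Since 24 * 26 + 1 = 625, 125 divides \<open>24 * m + 1\<close>. The quotient
    \<open>k\<close> is congruent to \<open>- r\<close> modulo 5, hence prime to 5.\<close>
  define k where "k = 120 * int n + 24 * int r + 5"
  have mk: "24 * int m + 1 = 125 * k" by (simp add: m_def k_def)
  have k5: "\<not> 5 dvd k"
  proof
    assume "5 dvd k"
    then have "5 dvd r" unfolding k_def by presburger
    then show False using assms by presburger
  qed
  define A where "A a = (pent_series m * theta a m) $ m" for a
  have A2: "A 2 = 0"
    unfolding A_def by (simp add: pent_theta_nth mk theta_reps_2_empty[OF k5])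
  have A1: "8 dvd A 1" and A4: "4 dvd A 4"
    using eight_dvd_theta_sum[OF k5] four_dvd_theta_sum[OF k5] unfolding A_def by (simp_all add: pent_theta_nth mk)
  have pent0: "pent_series m $ m = 0"
    by (rule pent_series_nth_eq_0) (simp add: mk theta_reps_2_empty[OF k5])
  have "[int (card (distinct_partitions m)) = (pent_series m * (2 * theta 2 m - theta 1 m)) $ m] (mod 8)"
    using distinct_gf_cong_8[of m] by (simp add: card_distinct_partitions[of m m] fps_cong_def)
  also have "(pent_series m * (2 * theta 2 m - theta 1 m)) $ m = 2 * A 2 - A 1"
  proof -
    have eq: "pent_series m * (2 * theta 2 m - theta 1 m) =
       pent_series m * theta 2 m + pent_series m * theta 2 m - pent_series m * theta 1 m"
      by (simp add: algebra_simps)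
    show ?thesis unfolding A_def eq fps_add_nth fps_sub_nth by simp
  qed
  finally have Q: "8 dvd int (card (distinct_partitions m))"
    using A1 A2 by (simp add: cong_dvd_iff)
  define c where "c = (pent_series m * (half_theta 2 m + half_theta 4 m)) $ m"
  \<comment> \<open>The sum of the half theta series is half of
    \<open>theta 2 m + theta 4 m - 2\<close>, and the constant -2 contributes nothing by
    \<open>pent0\<close>. As 4 divides \<open>A 2 + A 4\<close>, \<open>c\<close> is even.\<close>
  have "2 * c = A 2 + A 4"
  proof -
    have "pent_series m * theta 2 m + pent_series m * theta 4 m =
      (pent_series m + pent_series m) + (pent_series m * (half_theta 2 m + half_theta 4 m) + pent_series m * (half_theta 2 m + half_theta 4 m))"
      unfolding theta_eq_half_theta by (simp add: algebra_simps)
    then have "A 2 + A 4 = 2 * pent_series m $ m + 2 * c"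
      unfolding A_def c_def by (metis fps_add_nth mult_2)
    then show ?thesis by (simp add: pent0)
  qed
  then have "even c" using A2 A4 by presburger
  have "[int (double_odd_parts m) = c] (mod 2)"
    using double_odd_parts_cong[of m] fps_cong_mult[OF distinct_gf_cong_2[of m] fps_cong_refl, of "half_theta 2 m + half_theta 4 m"]
    unfolding c_def fps_cong_def by (meson cong_trans order_refl)
  then have "even (int (double_odd_parts m))" using \<open>even c\<close> cong_dvd_iff by blast
  then have "8 dvd 4 * int (double_odd_parts m)" by (elim evenE) simp
  then have "8 dvd int m * int (card (distinct_partitions m)) + 4 * int (double_odd_parts m)"
    using Q by (intro dvd_add[OF dvd_mult])
  then have "8 dvd DSOME m" using DSOME_cong[of m] by (simp add: cong_dvd_iff)
  then show ?thesis unfolding m_def by (simp add: cong_0_iff)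
qed

end
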